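(* Let $G$ be a bounded degree non-amenable (infinite, simple, connected) graph rooted at a vertex $o$. Let $(A_t)_{t\ge0}$ be DLA on $G$ started at $A_0=\{o\}$. Then, almost surely, $$0<\inf_{t>1}\,(\log t)^{-1}\cdot\mathrm{rad}(A_t)\le\limsup_{t\to\infty}\,(\log t)^{-1}\cdot\mathrm{rad}(A_t)<\infty ,$$ where $t$ ranges over integers.
   Context: For a graph $G$ rooted at $o$, $|x|=\mathrm{dist}(x,o)$ (graph distance), and for a finite set $A\subset G$, $\mathrm{rad}(A)=\max\{|x|:x\in A\}$. The outer boundary is $\partial A=\{x\notin A:\exists\, y\in A,\ y\sim x\}$. $G$ is non-amenable if $\inf_{A}|\partial A|/|A|>0$, the infimum being over finite nonempty $A\subset G$ (such graphs are transient). $(X_t)_t$ is the simple random walk on $G$, $\mathbb{P}_x$ its law when $X_0=x$, and $T_A^+=\inf\{t\ge1:X_t\in A\}$. For finite nonempty $A\subset G$: the equilibrium measure is $e_A(x)=\mathbf{1}_{\{x\in A\}}\deg(x)\,\mathbb{P}_x[T_A^+=\infty]$, the capacity is $\mathrm{cap}(A)=\sum_x e_A(x)$, and the harmonic measure (from infinity) is $h_A(x)=e_A(x)/\mathrm{cap}(A)$. DLA on $G$ started at a finite set $A_0$ is the Markov chain $(A_t)_{t\ge0}$ on finite subsets of $G$ in which, given $A_t$, a random vertex $a_{t+1}\in\partial A_t$ is chosen with $\mathbb{P}[a_{t+1}=x\mid A_t]=h_{A_t\cup\partial A_t}(x)$, and $A_{t+1}=A_t\cup\{a_{t+1}\}$.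 *)

theory Defs
  imports "HOL-Probability.Probability"
begin

text \<open>
  A simple graph is given by its adjacency relation \<open>E\<close>; the vertex set is the whole type \<open>'v\<close>.
\<close>

definition simple_graph :: "('v \<Rightarrow> 'v \<Rightarrow> bool) \<Rightarrow> bool" where
  "simple_graph E \<longleftrightarrow> symp E \<and> irreflp E"

definition connected_graph :: "('v \<Rightarrow> 'v \<Rightarrow> bool) \<Rightarrow> bool" where
  "connected_graph E \<longleftrightarrow> (\<forall>x y. E\<^sup>*\<^sup>* x y)"

definition nbrs :: "('v \<Rightarrow> 'v \<Rightarrow> bool) \<Rightarrow> 'v \<Rightarrow> 'v set" where
  "nbrs E x = {y. E x y}"

definition deg :: "('v \<Rightarrow> 'v \<Rightarrow> bool) \<Rightarrow> 'v \<Rightarrow> nat" where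
  "deg E x = card (nbrs E x)"

definition bounded_degree :: "('v \<Rightarrow> 'v \<Rightarrow> bool) \<Rightarrow> bool" where
  "bounded_degree E \<longleftrightarrow> (\<exists>d. \<forall>x. finite (nbrs E x) \<and> deg E x \<le> d)"

definition graph_dist :: "('v \<Rightarrow> 'v \<Rightarrow> bool) \<Rightarrow> 'v \<Rightarrow> 'v \<Rightarrow> nat" where
  "graph_dist E x y = (LEAST n. (E ^^ n) x y)"

definition rad :: "('v \<Rightarrow> 'v \<Rightarrow> bool) \<Rightarrow> 'v \<Rightarrow> 'v set \<Rightarrow> nat" where
  "rad E v0 A = Max ((\<lambda>x. graph_dist E x v0) ` A)"

definition outer_boundary :: "('v \<Rightarrow> 'v \<Rightarrow> bool) \<Rightarrow> 'v set \<Rightarrow> 'v set" where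
  "outer_boundary E A = {x. x \<notin> A \<and> (\<exists>y\<in>A. E y x)}"

definition nonamenable :: "('v \<Rightarrow> 'v \<Rightarrow> bool) \<Rightarrow> bool" where
  "nonamenable E \<longleftrightarrow>
    (INF A\<in>{A. finite A \<and> A \<noteq> {}}. real (card (outer_boundary E A)) / real (card A)) > 0"

text \<open>
  The law of simple random walk is built on trajectory space by the Ionescu-Tulcea theorem.
  \<open>srw_kernel E x n X\<close> is the law of the position at time \<open>n\<close> given the positions
  \<open>X 0, \<dots>, X (n - 1)\<close>. It is meaningful only if every vertex has finitely many and at least
  one neighbour, since \<open>pmf_of_set\<close> is unspecified on infinite and empty sets. Lemma
  \<open>srw_path\<close> below gives the resulting path probabilities.
\<close>

definition srw_kernel :: "('v \<Rightarrow> 'v \<Rightarrow> bool) \<Rightarrow> 'v \<Rightarrow> nat \<Rightarrow> (nat \<Rightarrow> 'v) \<Rightarrow> 'v measure" where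
  "srw_kernel E x n X =
    measure_pmf (if n = 0 then return_pmf x else pmf_of_set (nbrs E (X (n - 1))))"

interpretation srw_IT: Ionescu_Tulcea "srw_kernel E x" "\<lambda>_. count_space UNIV"
  for E :: "'v \<Rightarrow> 'v \<Rightarrow> bool" and x :: 'v
proof (rule Ionescu_Tulcea.intro)
  fix n
  show "srw_kernel E x n \<in> measurable (PiM {0..<n} (\<lambda>_. count_space UNIV))
      (subprob_algebra (count_space UNIV))"
  proof (cases "n = 0")
    case True
    then show ?thesis
      by (auto simp: srw_kernel_def[abs_def] measure_pmf_in_subprob_algebra)
  next
    case False
    then have "(\<lambda>X. X (n - 1)) \<in> measurable (PiM {0..<n} (\<lambda>_. count_space UNIV)) (count_space (UNIV :: 'v set))"
      by (intro measurable_component_singleton) auto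
    then have "(\<lambda>X. (\<lambda>y. measure_pmf (pmf_of_set (nbrs E y))) (X (n - 1)))
        \<in> measurable (PiM {0..<n} (\<lambda>_. count_space UNIV)) (subprob_algebra (count_space UNIV))"
      by (rule measurable_compose) (simp add: measure_pmf_in_subprob_algebra)
    with False show ?thesis
      by (simp add: srw_kernel_def[abs_def])
  qed
qed (simp add: srw_kernel_def prob_space_measure_pmf)

definition srw :: "('v \<Rightarrow> 'v \<Rightarrow> bool) \<Rightarrow> 'v \<Rightarrow> (nat \<Rightarrow> 'v) measure" where
  "srw E x = srw_IT.PF.lim E x"

lemma sets_srw: "sets (srw E x) = sets (PiM UNIV (\<lambda>_. count_space UNIV))"
  by (simp add: srw_def)

lemma emeasure_srw:
  assumes "J \<subseteq> {0..<n}" and "S \<in> sets (PiM J (\<lambda>_. count_space UNIV))"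
  shows "emeasure (srw E x) (prod_emb UNIV (\<lambda>_. count_space UNIV) J S) =
    emeasure (srw_IT.C E x 0 n (\<lambda>_. undefined)) (prod_emb {0..<n} (\<lambda>_. count_space UNIV) J S)"
  unfolding srw_def using assms
  by (subst srw_IT.lim) (auto intro: finite_subset srw_IT.emeasure_CI)

lemma prob_space_srw: "prob_space (srw E x)"
proof
  have "emeasure (srw E x) (space (srw E x)) =
      emeasure (srw E x) (prod_emb UNIV (\<lambda>_. count_space UNIV) {} {\<lambda>_. undefined})"
    by (simp add: srw_def prod_emb_def space_PiM restrict_def vimage_def)
  also have "\<dots> = emeasure (srw_IT.C E x 0 0 (\<lambda>_. undefined)) {\<lambda>_. undefined}"
    by (subst emeasure_srw[where n = 0])
       (auto simp: sets_PiM_empty prod_emb_def space_PiM PiM_empty)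
  also have "\<dots> = 1"
    by (simp add: PiM_empty)
  finally show "emeasure (srw E x) (space (srw E x)) = 1" .
qed

lemma srw_path:
  "emeasure (srw E x) {X. \<forall>i\<le>n. X i = p i} =
    (if p 0 = x then \<Prod>i<n. ennreal (pmf (pmf_of_set (nbrs E (p i))) (p (Suc i))) else 0)"
proof -
  let ?N = "\<lambda>_::nat. count_space (UNIV :: 'a set)"
  have sets: "(\<Pi>\<^sub>E i\<in>{0..<k}. {p i}) \<in> sets (PiM {0..<k} ?N)" for k
    by (intro sets_PiM_I_finite) auto
  have C: "emeasure (srw_IT.C E x 0 (Suc k) (\<lambda>_. undefined)) (\<Pi>\<^sub>E i\<in>{0..<Suc k}. {p i}) =
      emeasure (srw_IT.C E x 0 k (\<lambda>_. undefined)) (\<Pi>\<^sub>E i\<in>{0..<k}. {p i}) *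
      emeasure (srw_kernel E x k p) {p k}" for k
  proof -
    have eP: "emeasure (srw_IT.eP E x k X) (\<Pi>\<^sub>E i\<in>{0..<Suc k}. {p i}) =
        emeasure (srw_kernel E x k p) {p k} * indicator (\<Pi>\<^sub>E i\<in>{0..<k}. {p i}) X"
      if X: "X \<in> space (PiM {0..<k} ?N)" for X
    proof -
      have "(\<lambda>y. X(k := y)) -` (\<Pi>\<^sub>E i\<in>{0..<Suc k}. {p i}) =
          (if X \<in> (\<Pi>\<^sub>E i\<in>{0..<k}. {p i}) then {p k} else {})"
        using X by (force simp: PiE_iff extensional_def space_PiM atLeastLessThanSuc split: if_splits)
      moreover have "srw_kernel E x k X = srw_kernel E x k p" if "X \<in> (\<Pi>\<^sub>E i\<in>{0..<k}. {p i})"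
        using that by (cases k) (auto simp: srw_kernel_def PiE_iff)
      ultimately show ?thesis
        by (subst srw_IT.emeasure_eP[OF X sets]) (auto split: split_indicator)
    qed
    have "emeasure (srw_IT.C E x 0 (Suc k) (\<lambda>_. undefined)) (\<Pi>\<^sub>E i\<in>{0..<Suc k}. {p i}) =
        (\<integral>\<^sup>+X. emeasure (srw_IT.eP E x k X) (\<Pi>\<^sub>E i\<in>{0..<Suc k}. {p i})
          \<partial>srw_IT.C E x 0 k (\<lambda>_. undefined))"
      using srw_IT.measurable_eP[of E x k] sets[of "Suc k"] srw_IT.space_C[of "\<lambda>_. undefined" 0 E x k]
        srw_IT.sets_C[of "\<lambda>_. undefined" 0 E x k]
      by (simp, intro emeasure_bind[where N = "PiM {0..<Suc k} ?N"])
        (auto simp: space_PiM cong: measurable_cong_sets)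
    also have "\<dots> = (\<integral>\<^sup>+X. emeasure (srw_kernel E x k p) {p k} * indicator (\<Pi>\<^sub>E i\<in>{0..<k}. {p i}) X
          \<partial>srw_IT.C E x 0 k (\<lambda>_. undefined))"
      using srw_IT.space_C[of "\<lambda>_. undefined" 0 E x k]
      by (intro nn_integral_cong eP) simp
    also have "\<dots> = emeasure (srw_kernel E x k p) {p k} *
        emeasure (srw_IT.C E x 0 k (\<lambda>_. undefined)) (\<Pi>\<^sub>E i\<in>{0..<k}. {p i})"
      using sets[of k] srw_IT.sets_C[of "\<lambda>_. undefined" 0 E x k]
      by (intro nn_integral_cmult_indicator) simp
    finally show ?thesis
      by (simp add: mult.commute)
  qed
  have "emeasure (srw_IT.C E x 0 (Suc n) (\<lambda>_. undefined)) (\<Pi>\<^sub>E i\<in>{0..<Suc n}. {p i}) =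
    (if p 0 = x then \<Prod>i<n. ennreal (pmf (pmf_of_set (nbrs E (p i))) (p (Suc i))) else 0)"
  proof (induction n)
    case 0
    show ?case
      by (subst C) (auto simp: PiM_empty srw_kernel_def emeasure_pmf_single)
  next
    case (Suc n)
    show ?case
      by (subst C, subst Suc) (auto simp: srw_kernel_def emeasure_pmf_single)
  qed
  moreover have "{X. \<forall>i\<le>n. X i = p i} =
      prod_emb UNIV ?N {0..<Suc n} (\<Pi>\<^sub>E i\<in>{0..<Suc n}. {p i})"
    by (auto simp: prod_emb_def restrict_def PiE_iff extensional_def less_Suc_eq_le)
  ultimately show ?thesis
    using sets[of "Suc n"] by (simp add: emeasure_srw[where n = "Suc n"] prod_emb_id)
qed

text \<open>The infimum of the empty set is \<open>\<infinity>\<close> in \<^typ>\<open>enat\<close>.\<close>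

definition return_time :: "'v set \<Rightarrow> (nat \<Rightarrow> 'v) \<Rightarrow> enat" where
  "return_time A X = Inf {enat t | t. t \<ge> 1 \<and> X t \<in> A}"

definition equilibrium :: "('v \<Rightarrow> 'v \<Rightarrow> bool) \<Rightarrow> 'v set \<Rightarrow> 'v \<Rightarrow> real" where
  "equilibrium E A x =
    (if x \<in> A then real (deg E x) * \<P>(X in srw E x. return_time A X = \<infinity>) else 0)"

definition capacity :: "('v \<Rightarrow> 'v \<Rightarrow> bool) \<Rightarrow> 'v set \<Rightarrow> real" where
  "capacity E A = (\<Sum>x\<in>A. equilibrium E A x)"

definition harmonic_measure :: "('v \<Rightarrow> 'v \<Rightarrow> bool) \<Rightarrow> 'v set \<Rightarrow> 'v \<Rightarrow> real" where
  "harmonic_measure E A x = equilibrium E A x / capacity E A"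

text \<open>
  \<open>is_DLA E A0 M A\<close>: the process \<open>A\<close> on the probability space \<open>M\<close> is DLA started at \<open>A0\<close>. A
  history of positive probability is a sequence \<open>B 0, \<dots>, B t\<close> of finite sets; since
  \<open>x \<notin> B t\<close>, the event \<open>A (t + 1) = B t \<union> {x}\<close> says that the vertex added at time \<open>t + 1\<close>
  is \<open>x\<close>. Conditioning on the whole history rather than on \<open>A t\<close> alone is the Markov property.
\<close>

definition is_DLA ::
  "('v \<Rightarrow> 'v \<Rightarrow> bool) \<Rightarrow> 'v set \<Rightarrow> 'w measure \<Rightarrow> (nat \<Rightarrow> 'w \<Rightarrow> 'v set) \<Rightarrow> bool" where
  "is_DLA E A0 M A \<longleftrightarrow>
    prob_space M \<and>
    (\<forall>t. A t \<in> measurable M (count_space {B. finite B})) \<and>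
    (AE \<omega> in M. A 0 \<omega> = A0) \<and>
    (\<forall>t. AE \<omega> in M. \<exists>x\<in>outer_boundary E (A t \<omega>). A (Suc t) \<omega> = A t \<omega> \<union> {x}) \<and>
    (\<forall>t B x. \<P>(\<omega> in M. \<forall>s\<le>t. A s \<omega> = B s) > 0 \<longrightarrow> x \<in> outer_boundary E (B t) \<longrightarrow>
      \<P>(\<omega> in M. A (Suc t) \<omega> = B t \<union> {x} \<bar> \<forall>s\<le>t. A s \<omega> = B s) =
        harmonic_measure E (B t \<union> outer_boundary E (B t)) x)"

end

theory Submission
  imports Defs
begin

text \<open>
  Lower bound: \<open>A t\<close> has \<open>t + 1\<close> vertices, while balls grow at most exponentially.

  Upper bound: the probability of hitting \<open>B\<close> by time \<open>n\<close> is a function equal to \<open>1\<close> on \<open>B\<close> whose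
  Dirichlet energy is at most the sum of \<open>deg x\<close> times the escape probability over \<open>x \<in> B\<close>, so
  Cheeger's inequality gives \<open>cap B \<ge> c |B|\<close> and every vertex has harmonic measure at most \<open>C / t\<close>
  at time \<open>t\<close>. A boundary vertex is at most one step further out than some vertex of \<open>A t\<close>, so
  adding a vertex multiplies the expectation of the sum of \<open>exp |x|\<close> over \<open>x \<in> A t\<close> by at most
  \<open>1 + O(1 / t)\<close>. This expectation therefore grows polynomially; it dominates that of
  \<open>exp (rad (A t))\<close>, and Markov's inequality and Borel--Cantelli give \<open>rad (A t) = O(ln t)\<close>.
\<close>

section \<open>Cheeger's inequality\<close>

text \<open>Fixing \<open>d\<close> and \<open>\<phi>\<close> lets the later constants depend on
  them alone. \<open>nbrs_nonempty\<close> makes \<open>pmf_of_set (nbrs E x)\<close> a genuine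
  uniform law and keeps \<open>deg E x\<close> nonzero as a divisor.\<close>

locale isoperimetric_graph =
  fixes E :: "'v \<Rightarrow> 'v \<Rightarrow> bool" and d :: nat and \<phi> :: real
  assumes sym: "E x y \<Longrightarrow> E y x"
    and connected: "E\<^sup>*\<^sup>* x y"
    and finite_nbrs [simp]: "finite (nbrs E x)"
    and nbrs_nonempty [simp]: "nbrs E x \<noteq> {}"
    and deg_le: "deg E x \<le> d"
    and phi_pos: "0 < \<phi>"
    and isoperimetry: "finite A \<Longrightarrow> A \<noteq> {} \<Longrightarrow> \<phi> * card A \<le> card (outer_boundary E A)"
begin

lemma nbrs_sym: "y \<in> nbrs E x \<longleftrightarrow> x \<in> nbrs E y"
  using sym by (auto simp: nbrs_def)

lemma deg_pos: "0 < deg E x"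
  by (simp add: deg_def card_gt_0_iff)

lemma d_pos: "0 < d"
  using deg_pos deg_le by (metis gr0I leD)

lemma outer_boundary_eq: "outer_boundary E A = (\<Union>x\<in>A. nbrs E x - A)"
  by (auto simp: outer_boundary_def nbrs_def)

lemma finite_outer_boundary [simp]: "finite A \<Longrightarrow> finite (outer_boundary E A)"
  by (simp add: outer_boundary_eq)

text \<open>Layer-cake form of the isoperimetric inequality: integrated over the superlevel sets of
  \<open>f\<close> it gives the left side, while on the right a downhill edge is counted for every
  level between its end values. Induction over the support replaces the integral.\<close>

lemma coarea:
  fixes f :: "'v \<Rightarrow> real"
  assumes "finite S" "\<And>x. x \<in> S \<Longrightarrow> 0 < f x" "\<And>x. x \<notin> S \<Longrightarrow> f x = 0"
  shows "\<phi> * (\<Sum>x\<in>S. f x) \<le> (\<Sum>x\<in>S. \<Sum>y\<in>nbrs E x. max 0 (f x - f y))"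
  using assms
proof (induction S arbitrary: f rule: finite_psubset_induct)
  case (psubset S f)
  show ?case
  proof (cases "S = {}")
    case False
    \<comment> \<open>Peel off the bottom layer of height \<open>m\<close>, to which the isoperimetric inequality applies.\<close>
    define m where "m = Min (f ` S)"
    define g where "g x = (if x \<in> S then f x - m else 0)" for x
    define S' where "S' = {x \<in> S. 0 < g x}"
    have m_le: "m \<le> f x" if "x \<in> S" for x
      using that psubset.hyps by (simp add: m_def)
    have "m \<in> f ` S"
      using psubset.hyps False by (simp add: m_def)
    then obtain x0 where x0: "x0 \<in> S" "f x0 = m" by auto
    then have m_pos: "0 < m"
      using psubset.prems(1) by auto
    have "S' \<subset> S"
      using x0 by (auto simp: S'_def g_def)
    have g_nonneg: "0 \<le> g x" for x
      using m_le by (auto simp: g_def)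
    have g_zero: "g x = 0" if "x \<notin> S'" for x
      using that g_nonneg[of x] by (auto simp: S'_def g_def)
    have IH: "\<phi> * (\<Sum>x\<in>S'. g x) \<le> (\<Sum>x\<in>S'. \<Sum>y\<in>nbrs E x. max 0 (g x - g y))"
    proof (rule psubset.IH[OF \<open>S' \<subset> S\<close>])
      show "0 < g x" if "x \<in> S'" for x
        using that by (simp add: S'_def)
    qed (rule g_zero)
    have sumg: "(\<Sum>x\<in>S'. g x) = (\<Sum>x\<in>S. g x)"
      using \<open>S' \<subset> S\<close> psubset.hyps g_zero by (intro sum.mono_neutral_left) auto
    have sumgg: "(\<Sum>x\<in>S'. \<Sum>y\<in>nbrs E x. max 0 (g x - g y)) = (\<Sum>x\<in>S. \<Sum>y\<in>nbrs E x. max 0 (g x - g y))"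
    proof (intro sum.mono_neutral_left ballI)
      fix x assume "x \<in> S - S'"
      then have "max 0 (g x - g y) = 0" for y
        using g_zero[of x] g_nonneg[of y] by simp
      then show "(\<Sum>y\<in>nbrs E x. max 0 (g x - g y)) = 0" by simp
    qed (use \<open>S' \<subset> S\<close> psubset.hyps in auto)
    have "card (outer_boundary E S) \<le> (\<Sum>x\<in>S. card (nbrs E x - S))"
      unfolding outer_boundary_eq using psubset.hyps by (intro card_UN_le) auto
    then have "real (card (outer_boundary E S)) \<le> (\<Sum>x\<in>S. real (card (nbrs E x - S)))"
      by (metis of_nat_le_iff of_nat_sum)
    then have "\<phi> * card S \<le> (\<Sum>x\<in>S. real (card (nbrs E x - S)))"
      using isoperimetry[of S] psubset.hyps False by linarith
    then have iso: "m * (\<phi> * card S) \<le> m * (\<Sum>x\<in>S. real (card (nbrs E x - S)))"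
      using m_pos by (intro mult_left_mono) auto
    \<comment> \<open>Inside \<open>S\<close>, subtracting \<open>m\<close> preserves differences;
      across the boundary \<open>f y = g y = 0\<close>, so exactly \<open>m\<close> is lost.\<close>
    have layer: "max 0 (f x - f y) = max 0 (g x - g y) + (if y \<in> - S then m else 0)" if "x \<in> S" for x y
      using that m_le[of x] m_le[of y] m_pos psubset.prems by (auto simp: g_def max_def)
    have "(\<Sum>x\<in>S. \<Sum>y\<in>nbrs E x. max 0 (f x - f y))
        = (\<Sum>x\<in>S. (\<Sum>y\<in>nbrs E x. max 0 (g x - g y)) + m * real (card (nbrs E x - S)))"
    proof (intro sum.cong refl)
      fix x assume "x \<in> S"
      have "(\<Sum>y\<in>nbrs E x. if y \<in> - S then m else 0) = (\<Sum>y\<in>nbrs E x \<inter> - S. m)"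
        by (intro sum.inter_restrict[symmetric]) simp
      then show "(\<Sum>y\<in>nbrs E x. max 0 (f x - f y))
          = (\<Sum>y\<in>nbrs E x. max 0 (g x - g y)) + m * real (card (nbrs E x - S))"
        using \<open>x \<in> S\<close> by (simp add: layer sum.distrib Diff_eq del: Compl_iff)
    qed
    also have "\<dots> = (\<Sum>x\<in>S. \<Sum>y\<in>nbrs E x. max 0 (g x - g y)) + m * (\<Sum>x\<in>S. real (card (nbrs E x - S)))"
      by (simp add: sum.distrib sum_distrib_left)
    also have "\<dots> \<ge> \<phi> * (\<Sum>x\<in>S. g x) + m * (\<phi> * card S)"
      using IH iso by (simp add: sumg sumgg)
    also have "\<phi> * (\<Sum>x\<in>S. g x) + m * (\<phi> * card S) = \<phi> * (\<Sum>x\<in>S. f x)"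
      by (simp add: g_def sum_subtractf algebra_simps)
    finally show ?thesis .
  qed simp
qed

text \<open>Summation by parts: reversing edges shows that twice either side is the sum of
  \<open>(u x - u y)\<^sup>2\<close> over ordered pairs of neighbours.\<close>

lemma dirichlet_energy_symmetrize:
  fixes u :: "'v \<Rightarrow> real"
  assumes "finite S" and u: "\<And>x. 0 \<le> u x" "\<And>x. x \<notin> S \<Longrightarrow> u x = 0"
  shows "(\<Sum>x\<in>S. \<Sum>y\<in>nbrs E x. (max 0 (u x - u y))\<^sup>2) = (\<Sum>x\<in>S. \<Sum>y\<in>nbrs E x. u x * (u x - u y))"
proof -
  \<comment> \<open>Adding the neighbours of \<open>S\<close> gives a finite set containing both
    ends of every edge at \<open>S\<close>, so \<open>D\<close> is finite and closed under
    reversal.\<close>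
  define V where "V = S \<union> (\<Union>x\<in>S. nbrs E x)"
  define D where "D = (SIGMA x:V. nbrs E x \<inter> V)"
  have [simp]: "finite V"
    using assms by (simp add: V_def)
  have restrict: "(\<Sum>x\<in>S. \<Sum>y\<in>nbrs E x. F x y) = (\<Sum>(x,y)\<in>D. F x y)"
    if "\<And>x y. x \<notin> S \<Longrightarrow> F x y = 0" for F :: "'v \<Rightarrow> 'v \<Rightarrow> real"
  proof -
    have "(\<Sum>x\<in>S. \<Sum>y\<in>nbrs E x. F x y) = (\<Sum>x\<in>S. \<Sum>y\<in>nbrs E x \<inter> V. F x y)"
      by (intro sum.cong) (auto simp: V_def)
    also have "\<dots> = (\<Sum>x\<in>V. \<Sum>y\<in>nbrs E x \<inter> V. F x y)"
      using that \<open>finite V\<close> by (intro sum.mono_neutral_left) (simp_all, simp add: V_def)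
    finally show ?thesis
      by (simp add: D_def sum.Sigma)
  qed
  have swap: "(\<Sum>(x,y)\<in>D. F x y) = (\<Sum>(x,y)\<in>D. F y x)" for F :: "'v \<Rightarrow> 'v \<Rightarrow> real"
    by (rule sum.reindex_bij_witness[of _ prod.swap prod.swap]) (auto simp: D_def nbrs_sym)
  define P where "P = (\<Sum>(x,y)\<in>D. (max 0 (u x - u y))\<^sup>2)"
  define Q where "Q = (\<Sum>(x,y)\<in>D. u x * (u x - u y))"
  have "2 * P = P + (\<Sum>(x,y)\<in>D. (max 0 (u y - u x))\<^sup>2)"
    unfolding P_def by (subst (3) swap) simp
  also have "\<dots> = (\<Sum>(x,y)\<in>D. (u x - u y)\<^sup>2)"
    unfolding P_def
    by (auto simp: sum.distrib[symmetric] max_def power2_commute intro!: sum.cong)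
  also have "\<dots> = Q + (\<Sum>(x,y)\<in>D. u y * (u y - u x))"
    unfolding Q_def
    by (auto simp: sum.distrib[symmetric] power2_eq_square algebra_simps intro!: sum.cong)
  also have "\<dots> = 2 * Q"
    unfolding Q_def by (subst (2) swap) simp
  finally have "P = Q" by simp
  \<comment> \<open>Off \<open>S\<close>, \<open>u x = 0\<close> and \<open>u y \<ge> 0\<close> make
    both summands vanish, as \<open>restrict\<close> demands.\<close>
  then show ?thesis
    using u unfolding P_def Q_def by (subst (1 2) restrict) auto
qed

text \<open>\<open>coarea\<close> is applied to the square of \<open>u\<close>, and each difference
  of squares is split by a weighted AM-GM inequality into an energy term and a small multiple of
  \<open>(u x)\<^sup>2\<close>.\<close>

lemma cheeger:
  fixes u :: "'v \<Rightarrow> real"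
  assumes S: "finite S" and u: "\<And>x. 0 \<le> u x" "\<And>x. x \<notin> S \<Longrightarrow> u x = 0"
  shows "\<phi>\<^sup>2 / (4 * d) * (\<Sum>x\<in>S. (u x)\<^sup>2) \<le> (\<Sum>x\<in>S. \<Sum>y\<in>nbrs E x. u x * (u x - u y))"
proof -
  \<comment> \<open>With this weight the terms \<open>(u x)\<^sup>2 / a\<close> add up to at most
    half of the left side of \<open>coarea\<close>, so they can be absorbed.\<close>
  define a where "a = 2 * d / \<phi>"
  have a_pos: "0 < a"
    using d_pos phi_pos by (simp add: a_def)
  \<comment> \<open>\<open>coarea\<close> requires strict positivity on its set, so the zeros of
    \<open>u\<close> are dropped.\<close>
  define S' where "S' = {x \<in> S. 0 < u x}"
  have S': "finite S'" "S' \<subseteq> S" "\<And>x. x \<notin> S' \<Longrightarrow> u x = 0"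
    using S u(2) order.antisym[OF _ u(1)] by (auto simp: S'_def not_less)
  have "(\<Sum>x\<in>S. (u x)\<^sup>2) = (\<Sum>x\<in>S'. (u x)\<^sup>2)"
    using S S' by (intro sum.mono_neutral_right) auto
  then have "\<phi> * (\<Sum>x\<in>S. (u x)\<^sup>2) = \<phi> * (\<Sum>x\<in>S'. (u x)\<^sup>2)"
    by simp
  also have "\<dots> \<le> (\<Sum>x\<in>S'. \<Sum>y\<in>nbrs E x. max 0 ((u x)\<^sup>2 - (u y)\<^sup>2))"
  proof (rule coarea)
    show "0 < (u x)\<^sup>2" if "x \<in> S'" for x
      using that by (simp add: S'_def)
    show "(u x)\<^sup>2 = 0" if "x \<notin> S'" for x
      using S'(3)[OF that] by simp
  qed (rule S'(1))
  also have "\<dots> \<le> (\<Sum>x\<in>S. \<Sum>y\<in>nbrs E x. max 0 ((u x)\<^sup>2 - (u y)\<^sup>2))"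
    using S S' by (intro sum_mono2) (auto intro: sum_nonneg)
  also have "\<dots> \<le> (\<Sum>x\<in>S. \<Sum>y\<in>nbrs E x. a * (max 0 (u x - u y))\<^sup>2 + (u x)\<^sup>2 / a)"
  proof (intro sum_mono)
    fix x y
    show "max 0 ((u x)\<^sup>2 - (u y)\<^sup>2) \<le> a * (max 0 (u x - u y))\<^sup>2 + (u x)\<^sup>2 / a"
    proof (cases "u y \<le> u x")
      case True
      have "0 \<le> (a * (u x - u y) - u x)\<^sup>2 / a"
        using a_pos by simp
      also have "\<dots> = a * (u x - u y)\<^sup>2 + (u x)\<^sup>2 / a - 2 * (u x * (u x - u y))"
        using a_pos by (simp add: field_simps power2_eq_square)
      finally have "2 * (u x * (u x - u y)) \<le> a * (u x - u y)\<^sup>2 + (u x)\<^sup>2 / a" by simp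
      moreover have "(u x)\<^sup>2 - (u y)\<^sup>2 \<le> 2 * (u x * (u x - u y))"
        using sum_power2_ge_zero[of "u x - u y" 0] by (simp add: power2_eq_square algebra_simps)
      moreover have "(u y)\<^sup>2 \<le> (u x)\<^sup>2"
        using True u by (intro power_mono) auto
      ultimately show ?thesis
        using True by (simp add: max_def)
    next
      case False
      then have "(u x)\<^sup>2 \<le> (u y)\<^sup>2"
        using u by (intro power_mono) auto
      with False a_pos show ?thesis
        by (simp add: max_def)
    qed
  qed
  also have "\<dots> = a * (\<Sum>x\<in>S. \<Sum>y\<in>nbrs E x. (max 0 (u x - u y))\<^sup>2) + (\<Sum>x\<in>S. deg E x * ((u x)\<^sup>2 / a))"
    by (simp add: sum.distrib sum_distrib_left deg_def)
  also have "\<dots> \<le> a * (\<Sum>x\<in>S. \<Sum>y\<in>nbrs E x. (max 0 (u x - u y))\<^sup>2) + (\<Sum>x\<in>S. d * ((u x)\<^sup>2 / a))"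
    using a_pos deg_le by (intro add_left_mono sum_mono mult_right_mono) auto
  also have "(\<Sum>x\<in>S. d * ((u x)\<^sup>2 / a)) = \<phi> / 2 * (\<Sum>x\<in>S. (u x)\<^sup>2)"
    using d_pos phi_pos by (simp add: a_def sum_distrib_left field_simps)
  also have "(\<Sum>x\<in>S. \<Sum>y\<in>nbrs E x. (max 0 (u x - u y))\<^sup>2) = (\<Sum>x\<in>S. \<Sum>y\<in>nbrs E x. u x * (u x - u y))"
    using S u by (rule dirichlet_energy_symmetrize)
  finally have "\<phi> / 2 * (\<Sum>x\<in>S. (u x)\<^sup>2) \<le> a * (\<Sum>x\<in>S. \<Sum>y\<in>nbrs E x. u x * (u x - u y))"
    by (simp add: field_simps)
  then have "(\<phi> / 2 * (\<Sum>x\<in>S. (u x)\<^sup>2)) / a \<le> (\<Sum>x\<in>S. \<Sum>y\<in>nbrs E x. u x * (u x - u y))"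
    using a_pos by (simp add: pos_divide_le_eq mult.commute)
  then show ?thesis
    using d_pos phi_pos by (simp add: a_def field_simps power2_eq_square)
qed

section \<open>Capacity\<close>

text \<open>
  \<open>surv B n x\<close> is the probability that the walk started at \<open>x\<close> avoids \<open>B\<close> at all times
  \<open>1, \<dots>, n\<close>, expanded over the first step.
\<close>

primrec surv :: "'v set \<Rightarrow> nat \<Rightarrow> 'v \<Rightarrow> real" where
  "surv B 0 x = 1"
| "surv B (Suc n) x = (\<Sum>y\<in>nbrs E x - B. surv B n y) / deg E x"

lemma surv_nonneg: "0 \<le> surv B n x"
  by (induction n arbitrary: x) (auto intro!: sum_nonneg divide_nonneg_nonneg)

lemma surv_Suc_le: "surv B (Suc n) x \<le> surv B n x"
proof (induction n arbitrary: x)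
  case 0
  have "card (nbrs E x - B) \<le> deg E x"
    unfolding deg_def by (intro card_mono) auto
  then show ?case
    using deg_pos[of x] by simp
next
  case (Suc n)
  show ?case
    unfolding surv.simps(2)[of B "Suc n"] surv.simps(2)[of B n x]
    by (intro divide_right_mono sum_mono Suc) auto
qed

lemma surv_le_1: "surv B n x \<le> 1"
proof (induction n)
  case (Suc n)
  then show ?case
    using surv_Suc_le[of B n x] by linarith
qed simp

text \<open>In \<open>n\<close> steps the walk reaches \<open>B\<close> only from vertices at
  distance at most \<open>n\<close>; this gives the hitting probability the finite support that
  \<open>cheeger\<close> requires.\<close>

lemma finite_surv_support:
  assumes "finite B"
  shows "finite {x. surv B n x \<noteq> 1}"
proof (induction n)
  case (Suc n)
  have "{x. surv B (Suc n) x \<noteq> 1} \<subseteq> (\<Union>y\<in>B \<union> {x. surv B n x \<noteq> 1}. nbrs E y)"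
  proof
    fix x assume "x \<in> {x. surv B (Suc n) x \<noteq> 1}"
    then have *: "surv B (Suc n) x \<noteq> 1" by simp
    have "\<exists>y\<in>nbrs E x. y \<in> B \<or> surv B n y \<noteq> 1"
    proof (rule ccontr)
      assume "\<not> ?thesis"
      then have "nbrs E x - B = nbrs E x" "\<And>y. y \<in> nbrs E x \<Longrightarrow> surv B n y = 1" by auto
      then have "surv B (Suc n) x = 1"
        using deg_pos[of x] by (simp add: deg_def)
      with * show False by simp
    qed
    then show "x \<in> (\<Union>y\<in>B \<union> {x. surv B n x \<noteq> 1}. nbrs E y)"
      using nbrs_sym by auto
  qed
  then show ?case
    by (rule finite_subset) (use assms Suc in auto)
qed simp

text \<open>
  The hitting probability \<open>u\<close> of \<open>B\<close> within time \<open>n\<close> is subharmonic off \<open>B\<close>, so the terms of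
  its Dirichlet energy off \<open>B\<close> are nonpositive, while those on \<open>B\<close> are the escape probabilities.
\<close>

lemma sum_surv_ge:
  assumes "finite B"
  shows "\<phi>\<^sup>2 / (4 * d) * card B \<le> (\<Sum>x\<in>B. deg E x * surv B (Suc n) x)"
proof -
  \<comment> \<open>The value on \<open>B\<close> is set by hand because \<open>surv\<close> ignores
    time 0.\<close>
  define u where "u x = (if x \<in> B then 1 else 1 - surv B n x)" for x
  define S where "S = B \<union> {x. surv B n x \<noteq> 1}"
  have fin: "finite S"
    using assms finite_surv_support by (simp add: S_def)
  have u: "0 \<le> u x" "x \<notin> S \<Longrightarrow> u x = 0" for x
    using surv_le_1 by (auto simp: u_def S_def)
  \<comment> \<open>\<open>1 - u\<close> vanishes on \<open>B\<close>, so summing it over the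
    neighbours runs the recursion of \<open>surv\<close> one step; hence \<open>Suc n\<close> in the
    bound.\<close>
  have compl: "(\<Sum>y\<in>nbrs E x. 1 - u y) = deg E x * surv B (Suc n) x" for x
  proof -
    have "(\<Sum>y\<in>nbrs E x. 1 - u y) = (\<Sum>y\<in>nbrs E x. if y \<in> - B then surv B n y else 0)"
      by (intro sum.cong) (auto simp: u_def)
    also have "\<dots> = (\<Sum>y\<in>nbrs E x \<inter> - B. surv B n y)"
      by (intro sum.inter_restrict[symmetric]) simp
    finally show ?thesis
      using deg_pos[of x] by (simp add: Diff_eq)
  qed
  have "real (card B) = (\<Sum>x\<in>B. (u x)\<^sup>2)"
    by (simp add: u_def)
  also have "\<dots> \<le> (\<Sum>x\<in>S. (u x)\<^sup>2)"
    using fin by (intro sum_mono2) (auto simp: S_def)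
  finally have "\<phi>\<^sup>2 / (4 * d) * card B \<le> \<phi>\<^sup>2 / (4 * d) * (\<Sum>x\<in>S. (u x)\<^sup>2)"
    by (intro mult_left_mono) auto
  also have "\<dots> \<le> (\<Sum>x\<in>S. \<Sum>y\<in>nbrs E x. u x * (u x - u y))"
    using fin u by (rule cheeger)
  also have "\<dots> = (\<Sum>x\<in>S. u x * (deg E x * (surv B (Suc n) x - (1 - u x))))"
  proof (intro sum.cong refl)
    fix x
    have "(\<Sum>y\<in>nbrs E x. u x - u y) = (\<Sum>y\<in>nbrs E x. 1 - u y) - deg E x * (1 - u x)"
      by (simp add: sum_subtractf deg_def algebra_simps)
    then show "(\<Sum>y\<in>nbrs E x. u x * (u x - u y)) = u x * (deg E x * (surv B (Suc n) x - (1 - u x)))"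
      by (simp only: sum_distrib_left[symmetric] compl) (simp add: algebra_simps)
  qed
  also have "\<dots> \<le> (\<Sum>x\<in>S. if x \<in> B then deg E x * surv B (Suc n) x else 0)"
    using surv_le_1 surv_Suc_le[of B n]
    by (intro sum_mono) (auto simp: u_def simp del: surv.simps intro!: mult_nonneg_nonpos)
  also have "\<dots> = (\<Sum>x\<in>S \<inter> B. deg E x * surv B (Suc n) x)"
    using fin by (intro sum.inter_restrict[symmetric])
  also have "S \<inter> B = B"
    by (auto simp: S_def)
  finally show ?thesis .
qed

section \<open>Path expansion of survival probabilities, and the passage to escape
  probabilities\<close>

primrec avoiding_paths :: "'v set \<Rightarrow> nat \<Rightarrow> 'v \<Rightarrow> (nat \<Rightarrow> 'v) set" where
  "avoiding_paths B 0 x = {\<lambda>_. x}"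
| "avoiding_paths B (Suc n) x =
    (\<lambda>(y, p). case_nat x p) ` (SIGMA y:nbrs E x - B. avoiding_paths B n y)"

lemma finite_avoiding_paths [simp]: "finite (avoiding_paths B n x)"
  by (induction n arbitrary: x) auto

lemma avoiding_paths_0: "p \<in> avoiding_paths B n x \<Longrightarrow> p 0 = x"
  by (cases n) auto

lemma avoiding_paths_step: "p \<in> avoiding_paths B n x \<Longrightarrow> i < n \<Longrightarrow> p (Suc i) \<in> nbrs E (p i)"
proof (induction n arbitrary: x p i)
  case (Suc n)
  then show ?case
    by (cases i) (auto dest: avoiding_paths_0)
qed simp

lemma avoiding_paths_avoid: "p \<in> avoiding_paths B n x \<Longrightarrow> t \<in> {1..n} \<Longrightarrow> p t \<notin> B"
proof (induction n arbitrary: x p t)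
  case (Suc n)
  then obtain y q where *: "y \<in> nbrs E x - B" "q \<in> avoiding_paths B n y" "p = case_nat x q" by auto
  obtain s where "t = Suc s" "s \<le> n"
    using Suc.prems(2) by (cases t) auto
  then show ?case
    using * Suc.IH[OF *(2), of s] avoiding_paths_0[OF *(2)] by (cases s) auto
qed simp

text \<open>Members of \<open>avoiding_paths B n x\<close> are constant from time \<open>n\<close>
  on, so each finite path has one representative. This makes the cylinder events of distinct paths
  disjoint.\<close>

lemma avoiding_paths_eqI:
  "p \<in> avoiding_paths B n x \<Longrightarrow> q \<in> avoiding_paths B n x \<Longrightarrow> (\<And>i. i \<le> n \<Longrightarrow> p i = q i) \<Longrightarrow> p = q"
proof (induction n arbitrary: x p q)
  case (Suc n)
  then obtain y p' z q' where *: "p' \<in> avoiding_paths B n y" "p = case_nat x p'"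
    "q' \<in> avoiding_paths B n z" "q = case_nat x q'" by auto
  have eq: "p' i = q' i" if "i \<le> n" for i
    using Suc.prems(3)[of "Suc i"] that * by simp
  then have "y = z"
    using avoiding_paths_0 * by (metis le0)
  then show ?case
    using Suc.IH[of p' y q'] * eq by auto
qed auto

text \<open>Unrolling the recursion gives a sum of path weights, the form in which
  \<open>srw_path\<close> states cylinder probabilities.\<close>

lemma surv_eq_sum_paths:
  "surv B n x = (\<Sum>p\<in>avoiding_paths B n x. \<Prod>i<n. 1 / deg E (p i))"
proof (induction n arbitrary: x)
  case (Suc n)
  have inj: "inj_on (\<lambda>(y, p). case_nat x p) (SIGMA y:nbrs E x - B. avoiding_paths B n y)"
  proof (rule inj_onI, clarify)
    fix y p z q
    assume *: "p \<in> avoiding_paths B n y" "q \<in> avoiding_paths B n z" "case_nat x p = case_nat x q"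
    have "p = q"
      using fun_cong[OF *(3), of "Suc i" for i] by auto
    then show "y = z \<and> p = q"
      using * avoiding_paths_0 by metis
  qed
  have "surv B (Suc n) x = (\<Sum>y\<in>nbrs E x - B. \<Sum>p\<in>avoiding_paths B n y.
      1 / deg E x * (\<Prod>i<n. 1 / deg E (p i)))"
    by (simp add: Suc sum_divide_distrib)
  also have "\<dots> = (\<Sum>(y,p)\<in>(SIGMA y:nbrs E x - B. avoiding_paths B n y).
      1 / deg E x * (\<Prod>i<n. 1 / deg E (p i)))"
    by (simp add: sum.Sigma)
  also have "\<dots> = (\<Sum>p\<in>avoiding_paths B (Suc n) x. \<Prod>i<Suc n. 1 / deg E (p i))"
    unfolding avoiding_paths.simps
    by (subst sum.reindex[OF inj]) (auto simp: prod.lessThan_Suc_shift simp del: prod.lessThan_Suc intro!: sum.cong)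
  finally show ?case .
qed simp

lemma measurable_srw_component [measurable]:
  "(\<lambda>X. X t) \<in> measurable (srw E x) (count_space UNIV)"
  unfolding measurable_cong_sets[OF sets_srw refl] by (rule measurable_component_singleton) simp

lemma space_srw [simp]: "space (srw E x) = UNIV"
  using sets_eq_imp_space_eq[OF sets_srw, of E x] by (simp add: space_PiM)

lemma sets_avoid: "{X :: nat \<Rightarrow> 'v. \<forall>t\<in>{1..n}. X t \<notin> B} \<in> sets (srw E x)"
proof -
  have [measurable]: "Measurable.pred (count_space UNIV) (\<lambda>y. y \<notin> B)" by simp
  have "{X \<in> space (srw E x). \<forall>t\<in>{1..n}. X t \<notin> B} \<in> sets (srw E x)"
    by measurable
  then show ?thesis by simp
qed

text \<open>The cylinders of the avoiding paths are disjoint and contained in the event. This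
  direction suffices for a lower bound on the capacity.\<close>

lemma surv_le_prob:
  "surv B n x \<le> measure (srw E x) {X. \<forall>t\<in>{1..n}. X t \<notin> B}"
proof -
  interpret prob_space "srw E x" by (rule prob_space_srw)
  define C where "C p = {X :: nat \<Rightarrow> 'v. \<forall>i\<le>n. X i = p i}" for p
  have C_sets: "C p \<in> sets (srw E x)" for p
  proof -
    have "{X \<in> space (srw E x). \<forall>i\<in>{..n}. X i = p i} \<in> sets (srw E x)"
      by measurable
    then show ?thesis
      unfolding C_def by (simp only: Ball_def atMost_iff space_srw UNIV_I simp_thms)
  qed
  have "surv B n x = (\<Sum>p\<in>avoiding_paths B n x. measure (srw E x) (C p))"
    unfolding surv_eq_sum_paths
  proof (intro sum.cong refl)
    fix p assume p: "p \<in> avoiding_paths B n x"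
    have "emeasure (srw E x) (C p) = (\<Prod>i<n. ennreal (1 / deg E (p i)))"
      unfolding C_def srw_path using avoiding_paths_0[OF p] avoiding_paths_step[OF p]
      by (auto simp: deg_def intro!: prod.cong)
    also have "\<dots> = ennreal (\<Prod>i<n. 1 / deg E (p i))"
      by (rule prod_ennreal) simp
    finally show "(\<Prod>i<n. 1 / deg E (p i)) = measure (srw E x) (C p)"
      by (simp add: measure_def prod_nonneg)
  qed
  also have "\<dots> = measure (srw E x) (\<Union>p\<in>avoiding_paths B n x. C p)"
    using C_sets avoiding_paths_eqI[of _ B n x]
    by (intro finite_measure_finite_Union[symmetric])
      (auto simp: disjoint_family_on_def C_def)
  also have "\<dots> \<le> measure (srw E x) {X. \<forall>t\<in>{1..n}. X t \<notin> B}"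
    using avoiding_paths_avoid
    by (intro finite_measure_mono sets_avoid) (fastforce simp: C_def)
  finally show ?thesis .
qed

text \<open>Continuity from above; the intersection of the events is
  \<open>return_time B X = \<infinity>\<close> because the infimum of the empty set is
  \<open>\<infinity>\<close>.\<close>

lemma prob_avoid_tendsto:
  "(\<lambda>n. measure (srw E x) {X. \<forall>t\<in>{1..n}. X t \<notin> B})
    \<longlonglongrightarrow> \<P>(X in srw E x. return_time B X = \<infinity>)"
proof -
  interpret prob_space "srw E x" by (rule prob_space_srw)
  have sets: "range (\<lambda>n. {X :: nat \<Rightarrow> 'v. \<forall>t\<in>{1..n}. X t \<notin> B}) \<subseteq> sets (srw E x)"
    using sets_avoid by auto
  have "(\<Inter>n. {X :: nat \<Rightarrow> 'v. \<forall>t\<in>{1..n}. X t \<notin> B}) = {X. return_time B X = \<infinity>}"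
  proof (intro set_eqI iffI)
    fix X :: "nat \<Rightarrow> 'v" assume "X \<in> (\<Inter>n. {X :: nat \<Rightarrow> 'v. \<forall>t\<in>{1..n}. X t \<notin> B})"
    then have "{enat t | t. t \<ge> 1 \<and> X t \<in> B} = {}"
      by fastforce
    then show "X \<in> {X. return_time B X = \<infinity>}"
      unfolding return_time_def by (simp only: Inf_empty top_enat_def mem_Collect_eq)
  next
    fix X :: "nat \<Rightarrow> 'v" assume "X \<in> {X. return_time B X = \<infinity>}"
    then have "enat t = \<infinity>" if "t \<ge> 1" "X t \<in> B" for t
      using that Inf_lower[of "enat t" "{enat t | t. t \<ge> 1 \<and> X t \<in> B}"]
      by (auto simp: return_time_def)
    then show "X \<in> (\<Inter>n. {X :: nat \<Rightarrow> 'v. \<forall>t\<in>{1..n}. X t \<notin> B})"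
      by auto
  qed
  moreover have "decseq (\<lambda>n. {X :: nat \<Rightarrow> 'v. \<forall>t\<in>{1..n}. X t \<notin> B})"
    by (auto simp: decseq_def)
  ultimately show ?thesis
    using finite_Lim_measure_decseq[OF sets] by simp
qed

text \<open>The bound in \<open>sum_surv_ge\<close> does not depend on the number of steps, so it
  survives the limit.\<close>

lemma capacity_ge:
  assumes "finite B"
  shows "\<phi>\<^sup>2 / (4 * d) * card B \<le> capacity E B"
proof -
  have "(\<lambda>n. \<Sum>x\<in>B. deg E x * measure (srw E x) {X. \<forall>t\<in>{1..n}. X t \<notin> B})
      \<longlonglongrightarrow> (\<Sum>x\<in>B. deg E x * \<P>(X in srw E x. return_time B X = \<infinity>))"
    by (intro tendsto_sum tendsto_mult_left prob_avoid_tendsto)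
  moreover have "\<phi>\<^sup>2 / (4 * d) * card B
      \<le> (\<Sum>x\<in>B. deg E x * measure (srw E x) {X. \<forall>t\<in>{1..n}. X t \<notin> B})" if "1 \<le> n" for n
  proof -
    obtain k where n: "n = Suc k"
      using \<open>1 \<le> n\<close> by (cases n) auto
    have "\<phi>\<^sup>2 / (4 * d) * card B \<le> (\<Sum>x\<in>B. deg E x * surv B n x)"
      unfolding n by (rule sum_surv_ge) fact
    also have "\<dots> \<le> (\<Sum>x\<in>B. deg E x * measure (srw E x) {X. \<forall>t\<in>{1..n}. X t \<notin> B})"
      by (intro sum_mono mult_left_mono surv_le_prob) simp
    finally show ?thesis .
  qed
  ultimately show ?thesis
    unfolding capacity_def equilibrium_def by (auto intro!: LIMSEQ_le_const)
qed

section \<open>Bounds on harmonic measure\<close>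

lemma equilibrium_nonneg: "0 \<le> equilibrium E B x"
  by (simp add: equilibrium_def)

lemma equilibrium_le: "equilibrium E B x \<le> d"
proof -
  interpret prob_space "srw E x" by (rule prob_space_srw)
  have "real (deg E x) * \<P>(X in srw E x. return_time B X = \<infinity>) \<le> real d * 1"
    using deg_le by (intro mult_mono) auto
  then show ?thesis
    by (simp add: equilibrium_def)
qed

text \<open>Ensures that \<open>harmonic_measure\<close> divides by a nonzero capacity.\<close>

lemma capacity_pos:
  assumes "finite B" "B \<noteq> {}"
  shows "0 < capacity E B"
proof -
  have "0 < \<phi>\<^sup>2 / (4 * d) * card B"
    using assms phi_pos d_pos by (simp add: card_gt_0_iff)
  then show ?thesis
    using capacity_ge[OF assms(1)] by linarith
qed

lemma harmonic_measure_nonneg: "finite B \<Longrightarrow> 0 \<le> harmonic_measure E B x"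
  unfolding harmonic_measure_def capacity_def
  by (intro divide_nonneg_nonneg sum_nonneg equilibrium_nonneg)

lemma sum_harmonic_measure_le:
  assumes "finite B" "B \<noteq> {}" "C \<subseteq> B"
  shows "(\<Sum>x\<in>C. harmonic_measure E B x) \<le> 1"
proof -
  have "(\<Sum>x\<in>C. harmonic_measure E B x) \<le> (\<Sum>x\<in>B. harmonic_measure E B x)"
    using assms by (intro sum_mono2 harmonic_measure_nonneg) auto
  also have "\<dots> = 1"
    using capacity_pos[OF assms(1,2)]
    by (simp add: harmonic_measure_def sum_divide_distrib[symmetric] capacity_def)
  finally show ?thesis .
qed

text \<open>The equilibrium measure is at most \<open>d\<close> at each vertex, while the capacity
  is at least linear in the size. \<open>A\<close> is kept apart from \<open>B\<close> because DLA
  uses \<open>B = A \<union> outer_boundary E A\<close>, whereas the known size is that of the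
  cluster \<open>A\<close>.\<close>

lemma harmonic_measure_le:
  assumes "finite B" "A \<subseteq> B" "A \<noteq> {}"
  shows "harmonic_measure E B x \<le> 4 * d\<^sup>2 / \<phi>\<^sup>2 / card A"
proof -
  have fin: "finite A"
    using assms finite_subset by blast
  then have pos: "0 < \<phi>\<^sup>2 / (4 * d) * card A"
    using assms phi_pos d_pos by (simp add: card_gt_0_iff)
  have "\<phi>\<^sup>2 / (4 * d) * card A \<le> \<phi>\<^sup>2 / (4 * d) * card B"
    using assms by (intro mult_left_mono) (auto intro: card_mono)
  also have "\<dots> \<le> capacity E B"
    using assms by (intro capacity_ge)
  finally have "harmonic_measure E B x \<le> d / (\<phi>\<^sup>2 / (4 * d) * card A)"
    unfolding harmonic_measure_def using pos equilibrium_le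
    by (intro frac_le equilibrium_nonneg) auto
  also have "\<dots> = 4 * d\<^sup>2 / \<phi>\<^sup>2 / card A"
    by (simp add: power2_eq_square)
  finally show ?thesis .
qed

section \<open>Growth of DLA\<close>

lemma graph_dist_relpowp: "(E ^^ graph_dist E x y) x y"
proof -
  obtain n where "(E ^^ n) x y"
    using rtranclp_imp_relpowp[OF connected] by blast
  then show ?thesis
    unfolding graph_dist_def by (rule LeastI)
qed

lemma graph_dist_le: "(E ^^ n) x y \<Longrightarrow> graph_dist E x y \<le> n"
  unfolding graph_dist_def by (rule Least_le)

lemma graph_dist_self: "graph_dist E x x = 0"
  using graph_dist_le[of 0 x x] by simp

lemma graph_dist_nbrs: "x \<in> nbrs E y \<Longrightarrow> graph_dist E x z \<le> Suc (graph_dist E y z)"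
  using relpowp_Suc_I2[of E x y, OF sym graph_dist_relpowp]
  by (intro graph_dist_le) (simp add: nbrs_def)

text \<open>The next ball adds at most \<open>d\<close> neighbours for each vertex of the previous
  one. Finiteness is carried along because \<open>card\<close> of an infinite set is 0, so the bound
  alone would not imply it.\<close>

lemma card_graph_ball:
  "finite {x. graph_dist E x z \<le> r} \<and> card {x. graph_dist E x z \<le> r} \<le> (d + 1) ^ r"
proof (induction r)
  case 0
  have "x = z" if "graph_dist E x z = 0" for x
    using graph_dist_relpowp[of x z] that by simp
  then have "{x. graph_dist E x z \<le> 0} = {z}"
    by (auto simp: graph_dist_self)
  then show ?case by simp
next
  case (Suc r)
  let ?B = "\<lambda>r. {x. graph_dist E x z \<le> r}"
  have sub: "?B (Suc r) \<subseteq> ?B r \<union> (\<Union>y\<in>?B r. nbrs E y)"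
  proof
    fix x assume "x \<in> ?B (Suc r)"
    then consider "graph_dist E x z \<le> r" | "graph_dist E x z = Suc r"
      by fastforce
    then show "x \<in> ?B r \<union> (\<Union>y\<in>?B r. nbrs E y)"
    proof cases
      case 2
      then have "(E ^^ Suc r) x z"
        using graph_dist_relpowp[of x z] by metis
      then obtain y where "E x y" "(E ^^ r) y z"
        by (metis relpowp_Suc_D2)
      then show ?thesis
        using graph_dist_le[of r y z] sym[of x y] by (auto simp: nbrs_def)
    qed simp
  qed
  have fin: "finite (?B r \<union> (\<Union>y\<in>?B r. nbrs E y))"
    using Suc by auto
  have "card (\<Union>y\<in>?B r. nbrs E y) \<le> (\<Sum>y\<in>?B r. deg E y)"
    unfolding deg_def using Suc by (intro card_UN_le) auto
  also have "\<dots> \<le> card (?B r) * d"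
    using sum_bounded_above[of "?B r" "deg E" d] deg_le by simp
  finally have "card (?B r \<union> (\<Union>y\<in>?B r. nbrs E y)) \<le> card (?B r) + card (?B r) * d"
    using card_Un_le[of "?B r" "\<Union>y\<in>?B r. nbrs E y"] by linarith
  then have "card (?B (Suc r)) \<le> card (?B r) * (d + 1)"
    using card_mono[OF fin sub] by (simp add: algebra_simps)
  also have "\<dots> \<le> (d + 1) ^ r * (d + 1)"
    using Suc by (intro mult_right_mono) auto
  finally show ?case
    using finite_subset[OF sub fin] by (simp add: mult.commute)
qed

section \<open>The exponential potential and its one-step growth\<close>

definition potential :: "'v \<Rightarrow> 'v set \<Rightarrow> real" where
  "potential v0 A = (\<Sum>x\<in>A. exp (graph_dist E x v0))"

lemma potential_nonneg: "0 \<le> potential v0 A"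
  by (simp add: potential_def sum_nonneg)

lemma exp_rad_le_potential:
  assumes "finite A" "A \<noteq> {}"
  shows "exp (rad E v0 A) \<le> potential v0 A"
proof -
  have "rad E v0 A \<in> (\<lambda>x. graph_dist E x v0) ` A"
    unfolding rad_def using assms by (intro Max_in) auto
  then obtain x where "x \<in> A" "rad E v0 A = graph_dist E x v0" by auto
  then show ?thesis
    unfolding potential_def using assms
    by (auto intro!: member_le_sum[where f = "\<lambda>x. exp (real (graph_dist E x v0))"])
qed

text \<open>Each boundary vertex is charged to a neighbour in \<open>A\<close>: the weights differ
  by a factor at most \<open>exp 1\<close>, and a vertex of \<open>A\<close> is charged at most
  \<open>d\<close> times.\<close>

lemma potential_outer_boundary_le:
  assumes "finite A"
  shows "potential v0 (outer_boundary E A) \<le> d * exp 1 * potential v0 A"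
proof -
  define e where "e x = exp (real (graph_dist E x v0))" for x
  have image: "outer_boundary E A = snd ` (SIGMA y:A. nbrs E y - A)"
    by (force simp: outer_boundary_eq)
  have "potential v0 (outer_boundary E A) = sum e (outer_boundary E A)"
    by (simp add: potential_def e_def)
  also have "\<dots> \<le> sum (e \<circ> snd) (SIGMA y:A. nbrs E y - A)"
    unfolding image using assms by (intro sum_image_le) (auto simp: e_def)
  also have "\<dots> = (\<Sum>y\<in>A. \<Sum>x\<in>nbrs E y - A. e x)"
    using assms by (subst sum.Sigma) (auto intro!: sum.cong)
  also have "\<dots> \<le> (\<Sum>y\<in>A. d * (exp 1 * e y))"
  proof (rule sum_mono)
    fix y
    have "e x \<le> exp 1 * e y" if "x \<in> nbrs E y" for x
      using graph_dist_nbrs[OF that, of v0] by (simp add: e_def exp_add[symmetric])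
    then have "(\<Sum>x\<in>nbrs E y - A. e x) \<le> card (nbrs E y - A) * (exp 1 * e y)"
      by (intro sum_bounded_above) auto
    also have "card (nbrs E y - A) \<le> card (nbrs E y)"
      by (intro card_mono) auto
    then have "card (nbrs E y - A) * (exp 1 * e y) \<le> d * (exp 1 * e y)"
      using deg_le[of y] by (intro mult_right_mono) (auto simp: deg_def e_def)
    finally show "(\<Sum>x\<in>nbrs E y - A. e x) \<le> d * (exp 1 * e y)" .
  qed
  also have "\<dots> = d * exp 1 * potential v0 A"
    by (simp add: potential_def e_def sum_distrib_left mult.assoc)
  finally show ?thesis .
qed

text \<open>The factor \<open>4 * d\<^sup>2 / \<phi>\<^sup>2\<close> comes from
  \<open>harmonic_measure_le\<close> and \<open>d * exp 1\<close> from
  \<open>potential_outer_boundary_le\<close>.\<close>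

definition growth :: real where
  "growth = 4 * d ^ 3 * exp 1 / \<phi>\<^sup>2"

lemma growth_nonneg: "0 \<le> growth"
  by (simp add: growth_def)

text \<open>The new vertex lies outside \<open>A\<close>, so the potential gains exactly its weight.
  The old part is multiplied by a total mass at most 1, and the gain is summed with the uniform
  bound on \<open>h\<close>.\<close>

lemma expected_potential_step:
  fixes v0 :: 'v
  assumes "finite A" "A \<noteq> {}"
  defines "h \<equiv> harmonic_measure E (A \<union> outer_boundary E A)"
  shows "(\<Sum>x\<in>outer_boundary E A. h x * potential v0 (insert x A))
    \<le> (1 + growth / card A) * potential v0 A"
proof -
  let ?D = "outer_boundary E A"
  let ?e = "\<lambda>x. exp (real (graph_dist E x v0))"
  have "(\<Sum>x\<in>?D. h x * potential v0 (insert x A)) = (\<Sum>x\<in>?D. h x * potential v0 A + h x * ?e x)"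
    using assms by (intro sum.cong) (auto simp: outer_boundary_def potential_def algebra_simps)
  also have "\<dots> = (\<Sum>x\<in>?D. h x) * potential v0 A + (\<Sum>x\<in>?D. h x * ?e x)"
    by (simp add: sum.distrib sum_distrib_right)
  also have "(\<Sum>x\<in>?D. h x) * potential v0 A \<le> 1 * potential v0 A"
    unfolding h_def using assms
    by (intro mult_right_mono sum_harmonic_measure_le potential_nonneg) auto
  also have "(\<Sum>x\<in>?D. h x * ?e x) \<le> (\<Sum>x\<in>?D. 4 * d\<^sup>2 / \<phi>\<^sup>2 / card A * ?e x)"
    unfolding h_def using assms
    by (intro sum_mono mult_right_mono harmonic_measure_le) auto
  also have "\<dots> = 4 * d\<^sup>2 / \<phi>\<^sup>2 / card A * potential v0 ?D"
    by (simp add: potential_def sum_distrib_left)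
  also have "\<dots> \<le> 4 * d\<^sup>2 / \<phi>\<^sup>2 / card A * (d * exp 1 * potential v0 A)"
    using assms by (intro mult_left_mono potential_outer_boundary_le) auto
  also have "\<dots> = growth / card A * potential v0 A"
    by (simp add: growth_def power2_eq_square power3_eq_cube)
  finally show ?thesis
    by (simp add: algebra_simps)
qed

text \<open>
  The finitely many possible histories of DLA up to time \<open>t\<close>; only the values at times
  \<open>\<le> t\<close> are meaningful.
\<close>

primrec dla_histories :: "'v \<Rightarrow> nat \<Rightarrow> (nat \<Rightarrow> 'v set) set" where
  "dla_histories v0 0 = {\<lambda>_. {v0}}"
| "dla_histories v0 (Suc t) = (\<lambda>(B, x). B(Suc t := insert x (B t))) `
    (SIGMA B:dla_histories v0 t. outer_boundary E (B t))"

lemma dla_histories_card: "B \<in> dla_histories v0 t \<Longrightarrow> card (B t) = Suc t"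
proof (induction t arbitrary: B)
  case (Suc t)
  then obtain C x where "C \<in> dla_histories v0 t" "x \<in> outer_boundary E (C t)"
    "B = C(Suc t := insert x (C t))" by auto
  \<comment> \<open>Infinite sets have \<open>card\<close> 0, so the nonzero cardinality forces
    finiteness.\<close>
  moreover have "finite (C t)"
    using Suc.IH[OF calculation(1)] by (metis card.infinite nat.distinct(1))
  ultimately show ?case
    using Suc.IH[of C] by (simp add: outer_boundary_def)
qed auto

lemma dla_histories_finite [simp]: "B \<in> dla_histories v0 t \<Longrightarrow> finite (B t)"
  using dla_histories_card by (metis card.infinite nat.distinct(1))

lemma finite_dla_histories [simp]: "finite (dla_histories v0 t)"
  by (induction t) auto

end

section \<open>Expectations and almost sure bounds for the DLA process\<close>

locale nonamenable_dla = isoperimetric_graph E d \<phi> + prob_space M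
  for E :: "'v \<Rightarrow> 'v \<Rightarrow> bool" and d \<phi> and M :: "'w measure" +
  fixes v0 :: 'v and A :: "nat \<Rightarrow> 'w \<Rightarrow> 'v set"
  assumes dla: "is_DLA E {v0} M A"
begin

lemma sets_A: "{\<omega> \<in> space M. A t \<omega> \<in> X} \<in> events"
proof -
  have meas: "A t \<in> measurable M (count_space {B. finite B})"
    using dla by (simp add: is_DLA_def)
  have "{\<omega> \<in> space M. A t \<omega> \<in> X} = A t -` (X \<inter> {B. finite B}) \<inter> space M"
    using measurable_space[OF meas] by auto
  also have "\<dots> \<in> events"
    using meas by (rule measurable_sets) auto
  finally show ?thesis .
qed

definition hist_event :: "nat \<Rightarrow> (nat \<Rightarrow> 'v set) \<Rightarrow> 'w set" where
  "hist_event t B = {\<omega> \<in> space M. \<forall>s\<le>t. A s \<omega> = B s}"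

lemma sets_hist_event [simp, measurable]: "hist_event t B \<in> events"
proof -
  have "{\<omega> \<in> space M. \<forall>s\<in>{..t}. A s \<omega> \<in> {B s}} \<in> events"
    by (intro sets.sets_Collect_finite_All sets_A) auto
  then show ?thesis
    unfolding hist_event_def by (simp only: Ball_def atMost_iff singleton_iff)
qed

text \<open>Reduces events up to time \<open>t\<close>, modulo null sets, to finite unions of
  \<open>hist_event\<close>, so that sums over histories can replace integrals.\<close>

lemma AE_histories: "AE \<omega> in M. \<exists>B\<in>dla_histories v0 t. \<omega> \<in> hist_event t B"
proof (induction t)
  case 0
  have "AE \<omega> in M. A 0 \<omega> = {v0}"
    using dla by (simp add: is_DLA_def)
  with AE_space show ?case
    by eventually_elim (auto simp: hist_event_def)
next
  case (Suc t)
  have "AE \<omega> in M. \<exists>x\<in>outer_boundary E (A t \<omega>). A (Suc t) \<omega> = A t \<omega> \<union> {x}"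
    using dla by (simp add: is_DLA_def)
  with Suc show ?case
  proof eventually_elim
    case (elim \<omega>)
    then obtain B x where B: "B \<in> dla_histories v0 t" "\<omega> \<in> hist_event t B"
      and x: "x \<in> outer_boundary E (A t \<omega>)" "A (Suc t) \<omega> = A t \<omega> \<union> {x}" by auto
    let ?C = "B(Suc t := insert x (B t))"
    have "A t \<omega> = B t"
      using B by (simp add: hist_event_def)
    then have "\<omega> \<in> hist_event (Suc t) ?C" "?C \<in> dla_histories v0 (Suc t)"
      using B x by (auto simp: hist_event_def le_Suc_eq intro!: image_eqI[of _ _ "(B, x)"])
    then show ?case by blast
  qed
qed

lemma prob_hist_Suc:
  assumes "x \<in> outer_boundary E (B t)"
  shows "prob (hist_event (Suc t) (B(Suc t := insert x (B t)))) =
    harmonic_measure E (B t \<union> outer_boundary E (B t)) x * prob (hist_event t B)"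
proof (cases "prob (hist_event t B) = 0")
  case True
  \<comment> \<open>\<open>is_DLA\<close> prescribes nothing after a null history, but its extension
    is then null as well.\<close>
  have "hist_event (Suc t) (B(Suc t := insert x (B t))) \<subseteq> hist_event t B"
    by (auto simp: hist_event_def)
  then have "prob (hist_event (Suc t) (B(Suc t := insert x (B t)))) \<le> prob (hist_event t B)"
    by (intro finite_measure_mono) auto
  with True show ?thesis
    using measure_nonneg[of M "hist_event (Suc t) (B(Suc t := insert x (B t)))"] by simp
next
  case False
  then have "0 < \<P>(\<omega> in M. \<forall>s\<le>t. A s \<omega> = B s)"
    by (simp add: hist_event_def zero_less_measure_iff)
  then have "\<P>(\<omega> in M. A (Suc t) \<omega> = B t \<union> {x} \<bar> \<forall>s\<le>t. A s \<omega> = B s) =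
      harmonic_measure E (B t \<union> outer_boundary E (B t)) x"
    using dla assms unfolding is_DLA_def by blast
  moreover have "{\<omega> \<in> space M. A (Suc t) \<omega> = B t \<union> {x} \<and> (\<forall>s\<le>t. A s \<omega> = B s)}
      = hist_event (Suc t) (B(Suc t := insert x (B t)))"
    by (auto simp: hist_event_def le_Suc_eq)
  ultimately show ?thesis
    using False by (simp add: cond_prob_def hist_event_def[symmetric] field_simps)
qed

text \<open>The expectation of \<open>potential v0 (A t)\<close>, written over the finitely many
  histories.\<close>

definition expected_potential :: "nat \<Rightarrow> real" where
  "expected_potential t = (\<Sum>B\<in>dla_histories v0 t. potential v0 (B t) * prob (hist_event t B))"

lemma expected_potential_Suc:
  "expected_potential (Suc t) \<le> (1 + growth / Suc t) * expected_potential t"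
proof -
  let ?H = "dla_histories v0 t"
  let ?h = "\<lambda>B. harmonic_measure E (B t \<union> outer_boundary E (B t))"
  have "expected_potential (Suc t) \<le>
      (\<Sum>(B, x)\<in>(SIGMA B:?H. outer_boundary E (B t)).
        potential v0 (insert x (B t)) * prob (hist_event (Suc t) (B(Suc t := insert x (B t)))))"
    unfolding expected_potential_def dla_histories.simps
    \<comment> \<open>For nonnegative terms a sum over an image is at most the sum over the index
      set, which bypasses injectivity of the extension map.\<close>
    by (rule order.trans[OF sum_image_le])
      (auto simp: potential_nonneg intro!: sum_mono)
  also have "\<dots> = (\<Sum>B\<in>?H. \<Sum>x\<in>outer_boundary E (B t).
        potential v0 (insert x (B t)) * prob (hist_event (Suc t) (B(Suc t := insert x (B t)))))"
    by (intro sum.Sigma[symmetric]) auto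
  also have "\<dots> = (\<Sum>B\<in>?H. prob (hist_event t B) *
      (\<Sum>x\<in>outer_boundary E (B t). ?h B x * potential v0 (insert x (B t))))"
    unfolding sum_distrib_left by (intro sum.cong refl) (simp add: prob_hist_Suc)
  also have "\<dots> \<le> (\<Sum>B\<in>?H. prob (hist_event t B) * ((1 + growth / Suc t) * potential v0 (B t)))"
  proof (intro sum_mono mult_left_mono measure_nonneg)
    fix B assume B: "B \<in> ?H"
    then have "B t \<noteq> {}"
      using dla_histories_card by fastforce
    then show "(\<Sum>x\<in>outer_boundary E (B t). ?h B x * potential v0 (insert x (B t)))
        \<le> (1 + growth / Suc t) * potential v0 (B t)"
      using B expected_potential_step[of "B t" v0] dla_histories_card[OF B] by simp
  qed
  also have "\<dots> = (1 + growth / Suc t) * expected_potential t"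
    by (simp add: expected_potential_def sum_distrib_left mult_ac)
  finally show ?thesis .
qed

text \<open>For a natural number \<open>m\<close>, Bernoulli's inequality bounds the factor
  \<open>1 + growth / Suc t\<close> by \<open>(Suc (Suc t) / Suc t) ^ m\<close>, and the product of
  these telescopes.\<close>

lemma expected_potential_le:
  assumes "growth \<le> real m"
  shows "expected_potential t \<le> real (Suc t) ^ m"
proof (induction t)
  case 0
  then show ?case
    by (simp add: expected_potential_def potential_def graph_dist_self)
next
  case (Suc t)
  have "1 + growth / Suc t \<le> 1 + real m * (1 / Suc t)"
    using assms by (simp add: divide_right_mono)
  also have "\<dots> \<le> (1 + 1 / Suc t) ^ m"
    by (rule Bernoulli_inequality) (rule order.trans[of _ 0], auto)
  finally have step: "1 + growth / Suc t \<le> (1 + 1 / Suc t) ^ m" .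
  have "expected_potential (Suc t) \<le> (1 + growth / Suc t) * expected_potential t"
    by (rule expected_potential_Suc)
  also have "\<dots> \<le> (1 + growth / Suc t) * real (Suc t) ^ m"
    using growth_nonneg by (intro mult_left_mono Suc) auto
  also have "\<dots> \<le> (1 + 1 / Suc t) ^ m * real (Suc t) ^ m"
    using step by (intro mult_right_mono) auto
  also have "\<dots> = ((1 + 1 / Suc t) * real (Suc t)) ^ m"
    by (simp only: power_mult_distrib)
  also have "(1 + 1 / Suc t) * real (Suc t) = real (Suc (Suc t))"
    by (simp add: field_simps)
  finally show ?case .
qed

text \<open>Markov's inequality, carried out history by history.\<close>

lemma prob_potential_ge:
  assumes "0 < a"
  shows "prob {\<omega> \<in> space M. a \<le> potential v0 (A t \<omega>)} \<le> expected_potential t / a"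
proof -
  let ?H = "{B \<in> dla_histories v0 t. a \<le> potential v0 (B t)}"
  have "prob {\<omega> \<in> space M. a \<le> potential v0 (A t \<omega>)} \<le> prob (\<Union>B\<in>?H. hist_event t B)"
  proof (rule finite_measure_mono_AE)
    show "AE \<omega> in M. \<omega> \<in> {\<omega> \<in> space M. a \<le> potential v0 (A t \<omega>)} \<longrightarrow> \<omega> \<in> (\<Union>B\<in>?H. hist_event t B)"
      using AE_histories[of t] by eventually_elim (auto simp: hist_event_def)
  qed auto
  also have "\<dots> \<le> (\<Sum>B\<in>?H. prob (hist_event t B))"
    by (intro finite_measure_subadditive_finite) auto
  also have "\<dots> \<le> (\<Sum>B\<in>?H. potential v0 (B t) * prob (hist_event t B) / a)"
    using assms by (intro sum_mono) (auto simp: field_simps intro: mult_right_mono)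
  also have "\<dots> \<le> (\<Sum>B\<in>dla_histories v0 t. potential v0 (B t) * prob (hist_event t B) / a)"
    using assms potential_nonneg by (intro sum_mono2) auto
  also have "\<dots> = expected_potential t / a"
    by (simp add: expected_potential_def sum_divide_distrib)
  finally show ?thesis .
qed

lemma AE_card: "AE \<omega> in M. \<forall>t. card (A t \<omega>) = Suc t"
proof -
  have "AE \<omega> in M. card (A t \<omega>) = Suc t" for t
    using AE_histories[of t] by eventually_elim (auto simp: hist_event_def dla_histories_card)
  then show ?thesis
    by (simp add: AE_all_countable)
qed

lemma AE_rad_upper: "\<exists>c. AE \<omega> in M. eventually (\<lambda>t. rad E v0 (A t \<omega>) \<le> c * ln (Suc t)) sequentially"
proof -
  define m where "m = nat \<lceil>growth\<rceil>"
  have m: "growth \<le> real m"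
    unfolding m_def by linarith
  \<comment> \<open>The two powers beyond the bound on the expectation leave
    \<open>1 / (t + 1)\<^sup>2\<close>, which is summable as Borel-Cantelli requires.\<close>
  define X where "X t = {\<omega> \<in> space M. real (Suc t) ^ (m + 2) \<le> potential v0 (A t \<omega>)}" for t
  have X_sets: "X t \<in> events" for t
    using sets_A[of t "{B. real (Suc t) ^ (m + 2) \<le> potential v0 B}"] by (simp add: X_def)
  have le: "prob (X t) \<le> inverse (real (Suc t) ^ 2)" for t
  proof -
    have "prob (X t) \<le> expected_potential t / real (Suc t) ^ (m + 2)"
      unfolding X_def by (rule prob_potential_ge) simp
    also have "\<dots> \<le> real (Suc t) ^ m / real (Suc t) ^ (m + 2)"
      by (intro divide_right_mono expected_potential_le m) auto
    also have "\<dots> = inverse (real (Suc t) ^ 2)"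
      by (simp add: power_add power2_eq_square field_simps del: of_nat_Suc)
    finally show ?thesis .
  qed
  have "summable (\<lambda>t. inverse (real (Suc t) ^ 2))"
    using inverse_power_summable[of 2, where 'a = real] by (subst summable_Suc_iff) simp
  then have "summable (\<lambda>t. prob (X t))"
    by (rule summable_comparison_test_ev[rotated]) (use le in auto)
  then have "AE \<omega> in M. eventually (\<lambda>t. \<omega> \<in> space M - X t) sequentially"
    using X_sets by (intro borel_cantelli_AE1) (auto simp: emeasure_eq_measure)
  then have "AE \<omega> in M. eventually (\<lambda>t. rad E v0 (A t \<omega>) \<le> real (m + 2) * ln (Suc t)) sequentially"
    using AE_card
  proof eventually_elim
    case (elim \<omega>)
    from elim(1) show ?case
    proof eventually_elim
      case (elim t)
      have "card (A t \<omega>) = Suc t"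
        using \<open>\<forall>t. card (A t \<omega>) = Suc t\<close> by blast
      then have "finite (A t \<omega>)" "A t \<omega> \<noteq> {}"
        by (metis card.infinite nat.distinct(1), auto)
      then have "exp (rad E v0 (A t \<omega>)) \<le> potential v0 (A t \<omega>)"
        by (rule exp_rad_le_potential)
      also have "\<dots> \<le> real (Suc t) ^ (m + 2)"
        using elim unfolding X_def by (blast intro: less_imp_le not_le_imp_less)
      finally have "ln (exp (real (rad E v0 (A t \<omega>)))) \<le> ln (real (Suc t) ^ (m + 2))"
        by (intro ln_mono) auto
      then show ?case
        by (simp only: ln_exp ln_realpow of_nat_0_less_iff zero_less_Suc)
    qed
  qed
  then show ?thesis by blast
qed

text \<open>All \<open>t + 1\<close> vertices lie in the ball of radius
  \<open>rad E v0 (A t \<omega>)\<close>. Every \<open>t\<close> is covered, since the infimum runs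
  over all \<open>t > 1\<close> and not only over large ones.\<close>

lemma AE_rad_lower: "AE \<omega> in M. \<forall>t. ln (Suc t) \<le> rad E v0 (A t \<omega>) * ln (d + 1)"
  using AE_card
proof eventually_elim
  case (elim \<omega>)
  show ?case
  proof
    fix t
    have card: "card (A t \<omega>) = Suc t"
      using elim by blast
    then have fin: "finite (A t \<omega>)"
      by (metis card.infinite nat.distinct(1))
    then have "A t \<omega> \<subseteq> {x. graph_dist E x v0 \<le> rad E v0 (A t \<omega>)}"
      by (auto simp: rad_def)
    then have "Suc t \<le> (d + 1) ^ rad E v0 (A t \<omega>)"
      using card_graph_ball[of v0 "rad E v0 (A t \<omega>)"] card card_mono order.trans by metis
    then have "real (Suc t) \<le> real (d + 1) ^ rad E v0 (A t \<omega>)"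
      by (metis of_nat_le_iff of_nat_power)
    then have "ln (Suc t) \<le> ln (real (d + 1) ^ rad E v0 (A t \<omega>))"
      by (intro ln_mono) auto
    then show "ln (Suc t) \<le> rad E v0 (A t \<omega>) * ln (d + 1)"
      by (simp only: ln_realpow of_nat_0_less_iff zero_less_Suc Suc_eq_plus1[symmetric])
  qed
qed

lemma AE_rad_log:
  "AE \<omega> in M.
    0 < (INF t\<in>{1<..}. ereal (inverse (ln (real t)) * real (rad E v0 (A t \<omega>)))) \<and>
    (INF t\<in>{1<..}. ereal (inverse (ln (real t)) * real (rad E v0 (A t \<omega>))))
      \<le> limsup (\<lambda>t. ereal (inverse (ln (real t)) * real (rad E v0 (A t \<omega>)))) \<and>
    limsup (\<lambda>t. ereal (inverse (ln (real t)) * real (rad E v0 (A t \<omega>)))) < \<infinity>"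
proof -
  obtain c where c: "AE \<omega> in M. eventually (\<lambda>t. rad E v0 (A t \<omega>) \<le> c * ln (Suc t)) sequentially"
    using AE_rad_upper by blast
  from c AE_rad_lower show ?thesis
  proof eventually_elim
    case (elim \<omega>)
    let ?r = "\<lambda>t. rad E v0 (A t \<omega>)"
    let ?f = "\<lambda>t. ereal (inverse (ln (real t)) * real (?r t))"
    have lnd: "0 < ln (real (d + 1))"
      using d_pos by simp
    have "ereal (inverse (ln (real (d + 1)))) \<le> ?f t" if "1 < t" for t
    proof -
      have "0 < ln (real t)"
        using that by simp
      have "ln (real t) \<le> ln (real (Suc t))"
        using that by simp
      also have "\<dots> \<le> ?r t * ln (real (d + 1))"
        using elim(2) by (simp add: add.commute)
      finally show ?thesis
        using lnd \<open>0 < ln (real t)\<close> by (simp add: field_simps)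
    qed
    then have "ereal (inverse (ln (real (d + 1)))) \<le> (INF t\<in>{1<..}. ?f t)"
      by (intro INF_greatest) auto
    then have "0 < (INF t\<in>{1<..}. ?f t)"
      by (rule less_le_trans[rotated]) (use lnd in simp)
    \<comment> \<open>The limit superior sees only large \<open>t\<close>, for which
      \<open>?f t\<close> is among the terms of the infimum.\<close>
    moreover have "(INF t\<in>{1<..}. ?f t) \<le> limsup ?f"
      by (intro le_Limsup eventually_mono[OF eventually_gt_at_top[of 1]] INF_lower) auto
    moreover have "limsup ?f \<le> ereal (2 * \<bar>c\<bar>)"
    proof (rule Limsup_bounded)
      show "eventually (\<lambda>t. ?f t \<le> ereal (2 * \<bar>c\<bar>)) sequentially"
        using elim(1) eventually_gt_at_top[of 1]
      proof eventually_elim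
        case (elim t)
        have pos: "0 < ln (real t)"
          using elim by simp
        \<comment> \<open>For \<open>t \<ge> 2\<close>,
          \<open>t + 1 \<le> 2 * t \<le> t * t\<close>, which trades \<open>ln (t + 1)\<close> for
          \<open>2 * ln t\<close>.\<close>
        have "2 * real t \<le> real t * real t"
          using elim by (intro mult_right_mono) auto
        then have "real (Suc t) \<le> real t ^ 2"
          using elim unfolding power2_eq_square by linarith
        then have "ln (real (Suc t)) \<le> ln (real t ^ 2)"
          by (intro ln_mono) auto
        also have "\<dots> = 2 * ln (real t)"
          using elim by (simp add: ln_realpow)
        \<comment> \<open>The sign of \<open>c\<close> is unknown, hence the absolute value.\<close>
        finally have "c * ln (real (Suc t)) \<le> \<bar>c\<bar> * (2 * ln (real t))"
          by (intro mult_mono) auto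
        with elim have "real (?r t) \<le> 2 * \<bar>c\<bar> * ln (real t)"
          by simp
        then show ?case
          using pos by (simp add: field_simps)
      qed
    qed
    ultimately show ?case
      by (auto intro: le_less_trans)
  qed
qed

end

theorem theorem5p9:
  fixes E :: "'v \<Rightarrow> 'v \<Rightarrow> bool" and v0 :: 'v
    and M :: "'w measure" and A :: "nat \<Rightarrow> 'w \<Rightarrow> 'v set"
  assumes "simple_graph E" and "connected_graph E" and "infinite (UNIV :: 'v set)"
    and "bounded_degree E" and "nonamenable E"
    and "is_DLA E {v0} M A"
  shows "AE \<omega> in M.
    0 < (INF t\<in>{1<..}. ereal (inverse (ln (real t)) * real (rad E v0 (A t \<omega>)))) \<and>
    (INF t\<in>{1<..}. ereal (inverse (ln (real t)) * real (rad E v0 (A t \<omega>))))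
      \<le> limsup (\<lambda>t. ereal (inverse (ln (real t)) * real (rad E v0 (A t \<omega>)))) \<and>
    limsup (\<lambda>t. ereal (inverse (ln (real t)) * real (rad E v0 (A t \<omega>)))) < \<infinity>"
proof -
  obtain d where d: "\<And>x. finite (nbrs E x)" "\<And>x. deg E x \<le> d"
    using assms(4) by (auto simp: bounded_degree_def)
  let ?ratio = "\<lambda>A. real (card (outer_boundary E A)) / real (card A)"
  define \<phi> where "\<phi> = (INF A\<in>{A. finite A \<and> A \<noteq> {}}. ?ratio A)"
  have iso: "\<phi> * card B \<le> card (outer_boundary E B)" if "finite B" "B \<noteq> {}" for B
  proof -
    \<comment> \<open>A real-valued \<open>INF\<close> is a lower bound once the family is bounded
      below, here by 0.\<close>
    have "\<phi> \<le> ?ratio B"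
      unfolding \<phi>_def using that by (intro cINF_lower bdd_belowI2[of _ 0]) auto
    then show ?thesis
      using that by (simp add: le_divide_eq card_gt_0_iff)
  qed
  \<comment> \<open>A path from \<open>x\<close> to some other vertex must start with a neighbour of
    \<open>x\<close>.\<close>
  have nonempty: "nbrs E x \<noteq> {}" for x
  proof -
    obtain y where "y \<noteq> x"
      using assms(3) ex_new_if_finite[of "{x}"] by auto
    moreover have "E\<^sup>*\<^sup>* x y"
      using assms(2) by (simp add: connected_graph_def)
    ultimately show ?thesis
      by (auto simp: nbrs_def elim: converse_rtranclpE)
  qed
  have "prob_space M"
    using assms(6) by (simp add: is_DLA_def)
  moreover have "isoperimetric_graph E d \<phi>"
    using assms(1,2,5) d iso nonempty unfolding isoperimetric_graph_def
    by (auto simp: simple_graph_def connected_graph_def nonamenable_def \<phi>_def dest: sympD)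
  ultimately interpret nonamenable_dla E d \<phi> M v0 A
    using assms(6) by (auto intro!: nonamenable_dla.intro nonamenable_dla_axioms.intro)
  show ?thesis
    by (rule AE_rad_log)
qed

end
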